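(* Let $(A,\mu,\alpha)$ be a Hom-supercommutative algebra over a field $\mathbf{F}$, with $\mu(x,y)=xy$ and $\alpha$ even, and let $D:A\to A$ be an even derivation (i.e. an even linear map with $D(xy)=D(x)y+xD(y)$ for all $x,y\in A$) such that $D\alpha=\alpha D$. Define $x\ast y=xD(y)$ for all $x,y\in A$. Then $(A,\ast,\alpha)$ is a Hom-Novikov superalgebra.
   Context: $\mathbf{F}$ is an arbitrary field. All graded spaces are $\mathbb{Z}_2$-graded, $A=A_{\bar 0}\oplus A_{\bar 1}$, $|x|$ is the degree of a homogeneous element $x$, and identities involving signs are required for all homogeneous elements. A linear map $A\to A$ is even if it preserves degree; a bilinear map $\mu:A\times A\to A$ is even if $\mu(A_i,A_j)\subseteq A_{i+j}$. A Hom-associative superalgebra is a triple $(A,\mu,\alpha)$, where $A$ is a $\mathbb{Z}_2$-graded vector space, $\mu:A\times A\to A$, $\mu(x,y)=xy$, is an even bilinear map, and $\alpha:A\to A$ is a linear map, such that $\alpha(xy)=\alpha(x)\alpha(y)$ and $(xy)\alpha(z)=\alpha(x)(yz)$. A Hom-supercommutative algebra is a Hom-associative superalgebra whose multiplication is supercommutative: $xy=(-1)^{|x||y|}yx$. A Hom-Novikov superalgebra is a triple $(A,\cdot,\alpha)$, where $A$ is a $\mathbb{Z}_2$-graded vector space, $\cdot$ is an even bilinear product and $\alpha:A\to A$ is an even linear map, such that for all homogeneous $x,y,z$: (1) $\alpha(x\cdot y)=\alpha(x)\cdot\alpha(y)$; (2) $(x\cdot y)\cdot\alpha(z)-\alpha(x)\cdot(y\cdot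 z)=(-1)^{|x||y|}\big((y\cdot x)\cdot\alpha(z)-\alpha(y)\cdot(x\cdot z)\big)$; (3) $(x\cdot y)\cdot\alpha(z)=(-1)^{|y||z|}(x\cdot z)\cdot\alpha(y)$. *)

theory Defs
  imports Complex_Main "HOL-Library.Z2"
begin

text \<open>
  Gradings are indexed by the two-element field \<open>bit\<close>, read as the group of integers modulo 2, so
  that degrees add and multiply modulo 2. The ambient type is the whole graded space.
\<close>

locale super_space = vector_space scale
  for scale :: "'f::field \<Rightarrow> 'a::ab_group_add \<Rightarrow> 'a" +
  fixes G :: "bit \<Rightarrow> 'a set"
  assumes subspace_component: "subspace (G i)"
    and components_disjoint: "G 0 \<inter> G 1 = {0}"
    and components_span: "\<exists>u\<in>G 0. \<exists>v\<in>G 1. x = u + v"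

text \<open>\<open>koszul_sign i j\<close> is $(-1)^{ij}$ in the ground field.\<close>

definition koszul_sign :: "bit \<Rightarrow> bit \<Rightarrow> 'f::field" where
  "koszul_sign i j = (if i * j = 1 then - 1 else 1)"

definition even_map :: "(bit \<Rightarrow> 'a set) \<Rightarrow> ('a \<Rightarrow> 'a) \<Rightarrow> bool" where
  "even_map G f \<longleftrightarrow> (\<forall>i. \<forall>x\<in>G i. f x \<in> G i)"

locale superalgebra = super_space scale G
  for scale :: "'f::field \<Rightarrow> 'a::ab_group_add \<Rightarrow> 'a" and G :: "bit \<Rightarrow> 'a set" +
  fixes mult :: "'a \<Rightarrow> 'a \<Rightarrow> 'a"
  assumes linear_left: "Vector_Spaces.linear scale scale (\<lambda>x. mult x y)"
    and linear_right: "Vector_Spaces.linear scale scale (\<lambda>y. mult x y)"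
    and mult_even: "x \<in> G i \<Longrightarrow> y \<in> G j \<Longrightarrow> mult x y \<in> G (i + j)"

text \<open>
  The twisting map of a Hom-associative superalgebra is linear but not required to be even.
\<close>

locale hom_associative_superalgebra = superalgebra scale G mult
  for scale :: "'f::field \<Rightarrow> 'a::ab_group_add \<Rightarrow> 'a" and G :: "bit \<Rightarrow> 'a set"
    and mult :: "'a \<Rightarrow> 'a \<Rightarrow> 'a" +
  fixes \<alpha> :: "'a \<Rightarrow> 'a"
  assumes linear_twist: "Vector_Spaces.linear scale scale \<alpha>"
    and multiplicative: "\<alpha> (mult x y) = mult (\<alpha> x) (\<alpha> y)"
    and hom_associative: "mult (mult x y) (\<alpha> z) = mult (\<alpha> x) (mult y z)"

locale hom_supercommutative_algebra = hom_associative_superalgebra scale G mult \<alpha>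
  for scale :: "'f::field \<Rightarrow> 'a::ab_group_add \<Rightarrow> 'a" and G :: "bit \<Rightarrow> 'a set"
    and mult :: "'a \<Rightarrow> 'a \<Rightarrow> 'a" and \<alpha> :: "'a \<Rightarrow> 'a" +
  assumes supercommutative:
    "x \<in> G i \<Longrightarrow> y \<in> G j \<Longrightarrow> mult x y = scale (koszul_sign i j) (mult y x)"

locale hom_novikov_superalgebra = superalgebra scale G mult
  for scale :: "'f::field \<Rightarrow> 'a::ab_group_add \<Rightarrow> 'a" and G :: "bit \<Rightarrow> 'a set"
    and mult :: "'a \<Rightarrow> 'a \<Rightarrow> 'a" +
  fixes \<alpha> :: "'a \<Rightarrow> 'a"
  assumes linear_twist: "Vector_Spaces.linear scale scale \<alpha>"
    and even_twist: "even_map G \<alpha>"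
    and multiplicative:
      "x \<in> G i \<Longrightarrow> y \<in> G j \<Longrightarrow> \<alpha> (mult x y) = mult (\<alpha> x) (\<alpha> y)"
    and left_symmetric:
      "x \<in> G i \<Longrightarrow> y \<in> G j \<Longrightarrow> z \<in> G k \<Longrightarrow>
        mult (mult x y) (\<alpha> z) - mult (\<alpha> x) (mult y z) =
        scale (koszul_sign i j) (mult (mult y x) (\<alpha> z) - mult (\<alpha> y) (mult x z))"
    and right_commutative:
      "x \<in> G i \<Longrightarrow> y \<in> G j \<Longrightarrow> z \<in> G k \<Longrightarrow>
        mult (mult x y) (\<alpha> z) = scale (koszul_sign j k) (mult (mult x z) (\<alpha> y))"

definition even_derivation ::
  "('f::field \<Rightarrow> 'a::ab_group_add \<Rightarrow> 'a) \<Rightarrow> (bit \<Rightarrow> 'a set) \<Rightarrow> ('a \<Rightarrow> 'a \<Rightarrow> 'a) \<Rightarrow> ('a \<Rightarrow> 'a) \<Rightarrow> bool"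
  where "even_derivation scale G mult D \<longleftrightarrow>
    Vector_Spaces.linear scale scale D \<and> even_map G D \<and>
    (\<forall>x y. D (mult x y) = mult (D x) y + mult x (D y))"

end

theory Submission
  imports Defs
begin

text \<open>
  By Hom-associativity and the Leibniz rule the associator of \<open>x \<ast> y = x D(y)\<close> collapses to
  \<open>- (x y) \<alpha>(D(D z))\<close>, and \<open>(x \<ast> y) \<ast> \<alpha>(z)\<close> equals \<open>\<alpha>(x) (D(y) D(z))\<close>. The two Novikov identities
  are then supercommutativity of \<open>x y\<close> and of \<open>D(y) D(z)\<close>.
\<close>

theorem theorem2p9:
  fixes scale :: "'f::field \<Rightarrow> 'a::ab_group_add \<Rightarrow> 'a"
    and G :: "bit \<Rightarrow> 'a set"
    and mult :: "'a \<Rightarrow> 'a \<Rightarrow> 'a"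
    and \<alpha> D :: "'a \<Rightarrow> 'a"
  assumes "hom_supercommutative_algebra scale G mult \<alpha>"
    and "even_map G \<alpha>"
    and "even_derivation scale G mult D"
    and "D \<circ> \<alpha> = \<alpha> \<circ> D"
  shows "hom_novikov_superalgebra scale G (\<lambda>x y. mult x (D y)) \<alpha>"
proof -
  interpret hom_supercommutative_algebra scale G mult \<alpha> by fact
  have D_linear: "Vector_Spaces.linear scale scale D"
    and D_even: "\<And>i x. x \<in> G i \<Longrightarrow> D x \<in> G i"
    and leibniz: "\<And>x y. D (mult x y) = mult (D x) y + mult x (D y)"
    using assms(3) by (auto simp: even_derivation_def even_map_def)
  have commute: "D (\<alpha> x) = \<alpha> (D x)" for x
    using assms(4) by (simp add: fun_eq_iff)
  have add_right: "mult x (y + z) = mult x y + mult x z" for x y z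
    \<comment> \<open>The third axiom of \<open>Vector_Spaces.linear\<close>, after the two vector
      space ones, is \<open>module_hom\<close>.\<close>
    by (rule module_hom.add[OF Vector_Spaces.linear.axioms(3)[OF linear_right]])
  have scale_left: "mult (scale c x) y = scale c (mult x y)" for c x y
    by (rule module_hom.scale[OF Vector_Spaces.linear.axioms(3)[OF linear_left]])
  have scale_right: "mult x (scale c y) = scale c (mult x y)" for c x y
    by (rule module_hom.scale[OF Vector_Spaces.linear.axioms(3)[OF linear_right]])
  \<comment> \<open>The Leibniz term \<alpha>(x)(D(y) D(z)) cancels the first product. Regrouping
    the remainder \<alpha>(x)(y D(D z)) to the left isolates \<open>mult x y\<close>, the only place
    where x and y occur.\<close>
  have associator:
    "mult (mult x (D y)) (D (\<alpha> z)) - mult (\<alpha> x) (D (mult y (D z))) = - mult (mult x y) (\<alpha> (D (D z)))"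
    for x y z
    by (simp add: commute leibniz add_right hom_associative)
  show ?thesis
  proof (intro hom_novikov_superalgebra.intro superalgebra.intro
      superalgebra_axioms.intro hom_novikov_superalgebra_axioms.intro)
    show "super_space scale G" ..
    show "Vector_Spaces.linear scale scale (\<lambda>x. mult x (D y))" for y
      by (rule linear_left)
    show "Vector_Spaces.linear scale scale (\<lambda>y. mult x (D y))" for x
      using Vector_Spaces.linear_compose[OF D_linear linear_right[of x]] by (simp add: o_def)
    show "mult x (D y) \<in> G (i + j)" if "x \<in> G i" "y \<in> G j" for x y i j
      using that by (intro mult_even D_even)
    show "Vector_Spaces.linear scale scale \<alpha>"
      by (rule linear_twist)
    show "even_map G \<alpha>" by fact
    show "\<alpha> (mult x (D y)) = mult (\<alpha> x) (D (\<alpha> y))" for x y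
      by (simp add: commute multiplicative)
    show "mult (mult x (D y)) (D (\<alpha> z)) - mult (\<alpha> x) (D (mult y (D z))) =
        scale (koszul_sign i j)
          (mult (mult y (D x)) (D (\<alpha> z)) - mult (\<alpha> y) (D (mult x (D z))))"
      if "x \<in> G i" "y \<in> G j" for x y z i j
      \<comment> \<open>Here \<open>hom_associative\<close> stays out of the simplification, so that
        \<open>mult x y\<close> remains visible for the swap.\<close>
      unfolding associator using supercommutative[OF that]
      by (simp add: scale_left)
    show "mult (mult x (D y)) (D (\<alpha> z)) =
        scale (koszul_sign j k) (mult (mult x (D z)) (D (\<alpha> y)))"
      if "y \<in> G j" "z \<in> G k" for x y z j k
      \<comment> \<open>As \<open>D\<close> preserves degrees, swapping D(y) and D(z) costs the same
        sign as swapping y and z. Now \<open>hom_associative\<close> is used to make their product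
        the right factor.\<close>
      using supercommutative[OF D_even[OF that(1)] D_even[OF that(2)]]
      by (simp add: commute hom_associative scale_right)
  qed
qed

end
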